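(* Let $\mathcal{Z}$ be a finite zero-set, and let $a$ and $b$ be the sizes of the longest row and the longest column of $\mathcal{Z}$, respectively. If $m,n\in\mathbb{N}$ satisfy $m,n>ab$, then $$\gamma^2(\mathcal{Z},m,n)=\min(bx+ay-xy),$$ where the minimum is over all concave corners $(x,y)$ of $\mathcal{Z}$.
   Context: $\mathbb{Z}_+=\{0,1,2,\dots\}$, $\mathbb{N}=\{1,2,\dots\}$, $[0,c]=\{0,\dots,c\}$, $R_{n,m}=[0,n-1]\times[0,m-1]$. A zero-set (Young diagram) is a downward-closed set $\mathcal{Z}\subseteq\mathbb{Z}_+^2$; its rows are the sets of its points with a given second coordinate, its columns the sets of its points with a given first coordinate (so $a=|\{x\colon(x,0)\in\mathcal{Z}\}|$ and $b=|\{y\colon(0,y)\in\mathcal{Z}\}|$). A concave corner of $\mathcal{Z}$ is a minimal point of $\mathbb{Z}_+^2\setminus\mathcal{Z}$ in the coordinatewise partial order. The graph $K_m\Box K_n$ is represented on the vertex set $R_{n,m}$, with two vertices adjacent iff they differ in exactly one coordinate. For $v=(j,i)\in R_{n,m}$, $\mathcal{N}^r(v)$ is the set of all $(j',i)\in R_{n,m}$ with $j'\ne j$ and $\mathcal{N}^c(v)$ the set of all $(j,i')\in R_{n,m}$ with $i'\neq i$. For $A\subseteq R_{n,m}$ let $\mathcal{T}(A)=A\cup\{v\in R_{n,m}\setminus A\colon(|\mathcal{N}^r(v)\cap A|,|\mathcal{N}^c(v)\cap A|)\notin\mathcal{Z}\}$. Then $\gamma^2(\mathcal{Z},m,n)=\min\{|A|\colon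 A\subseteq R_{n,m},\ \mathcal{T}(\mathcal{T}(A))=R_{n,m}\}$. *)

theory Defs
  imports Main "HOL-Library.Product_Order"
begin

text \<open>
  Points of the nonnegative integer quadrant have type \<open>nat \<times> nat\<close>; \<open>(\<le>)\<close> on this type is the
  coordinatewise order of \<open>HOL-Library.Product_Order\<close>.
\<close>

definition zero_set :: "(nat \<times> nat) set \<Rightarrow> bool" where
  "zero_set Z \<longleftrightarrow> (\<forall>p\<in>Z. \<forall>q. q \<le> p \<longrightarrow> q \<in> Z)"

definition row :: "(nat \<times> nat) set \<Rightarrow> nat \<Rightarrow> (nat \<times> nat) set" where
  "row Z y = {p \<in> Z. snd p = y}"

definition column :: "(nat \<times> nat) set \<Rightarrow> nat \<Rightarrow> (nat \<times> nat) set" where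
  "column Z x = {p \<in> Z. fst p = x}"

text \<open>
  For finite \<open>Z\<close> only finitely many rows and columns are nonempty, so these maxima are over
  finite sets of numbers.
\<close>

definition longest_row :: "(nat \<times> nat) set \<Rightarrow> nat" where
  "longest_row Z = Max (range (\<lambda>y. card (row Z y)))"

definition longest_column :: "(nat \<times> nat) set \<Rightarrow> nat" where
  "longest_column Z = Max (range (\<lambda>x. card (column Z x)))"

definition concave_corners :: "(nat \<times> nat) set \<Rightarrow> (nat \<times> nat) set" where
  "concave_corners Z = {p. p \<notin> Z \<and> (\<forall>q. q \<notin> Z \<longrightarrow> q \<le> p \<longrightarrow> q = p)}"

definition rect :: "nat \<Rightarrow> nat \<Rightarrow> (nat \<times> nat) set" where
  "rect n m = {0..<n} \<times> {0..<m}"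

definition row_nbrs :: "nat \<Rightarrow> nat \<Rightarrow> nat \<times> nat \<Rightarrow> (nat \<times> nat) set" where
  "row_nbrs n m v = {w \<in> rect n m. snd w = snd v \<and> fst w \<noteq> fst v}"

definition col_nbrs :: "nat \<Rightarrow> nat \<Rightarrow> nat \<times> nat \<Rightarrow> (nat \<times> nat) set" where
  "col_nbrs n m v = {w \<in> rect n m. fst w = fst v \<and> snd w \<noteq> snd v}"

definition growth_step ::
  "(nat \<times> nat) set \<Rightarrow> nat \<Rightarrow> nat \<Rightarrow> (nat \<times> nat) set \<Rightarrow> (nat \<times> nat) set" where
  "growth_step Z n m A =
     A \<union> {v \<in> rect n m - A. (card (row_nbrs n m v \<inter> A), card (col_nbrs n m v \<inter> A)) \<notin> Z}"

text \<open>Note the order of the last two arguments: \<open>gamma2 Z m n\<close> lives on \<open>rect n m\<close>.\<close>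

definition gamma2 :: "(nat \<times> nat) set \<Rightarrow> nat \<Rightarrow> nat \<Rightarrow> nat" where
  "gamma2 Z m n =
     Min (card ` {A. A \<subseteq> rect n m \<and> growth_step Z n m (growth_step Z n m A) = rect n m})"

text \<open>\<open>Min\<close> in \<open>gamma2\<close>, and over the concave corners of a finite zero-set, is taken over a finite nonempty set.\<close>

lemma gamma2_candidates:
  shows "finite {A. A \<subseteq> rect n m \<and> growth_step Z n m (growth_step Z n m A) = rect n m}"
    and "rect n m \<in> {A. A \<subseteq> rect n m \<and> growth_step Z n m (growth_step Z n m A) = rect n m}"
proof -
  have "finite (Pow (rect n m))" by (simp add: rect_def)
  then show "finite {A. A \<subseteq> rect n m \<and> growth_step Z n m (growth_step Z n m A) = rect n m}"
    by (rule rev_finite_subset) blast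
  have "growth_step Z n m (rect n m) = rect n m"
    unfolding growth_step_def by blast
  then show "rect n m \<in> {A. A \<subseteq> rect n m \<and> growth_step Z n m (growth_step Z n m A) = rect n m}"
    by simp
qed

lemma concave_corner_below:
  fixes p :: "nat \<times> nat"
  assumes "p \<notin> Z"
  shows "\<exists>c\<in>concave_corners Z. c \<le> p"
  using assms
proof (induction "fst p + snd p" arbitrary: p rule: less_induct)
  case less
  show ?case
  proof (cases "p \<in> concave_corners Z")
    case False
    then obtain q where q: "q \<notin> Z" "q \<le> p" "q \<noteq> p"
      using less.prems by (auto simp: concave_corners_def)
    then have "fst q + snd q < fst p + snd p"
      by (cases p, cases q) auto
    from less.hyps[OF this q(1)] obtain c where "c \<in> concave_corners Z" "c \<le> q" ..
    with q(2) show ?thesis by (blast intro: order_trans)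
  next
    case True
    then show ?thesis by (rule bexI[rotated]) simp
  qed
qed

lemma concave_corners_finite_nonempty:
  fixes Z :: "(nat \<times> nat) set"
  assumes "finite Z"
  shows "finite (concave_corners Z)" and "concave_corners Z \<noteq> {}"
proof -
  obtain k where k: "\<And>x y. (x, y) \<in> Z \<Longrightarrow> x < k \<and> y < k"
  proof -
    have "finite (fst ` Z \<union> snd ` Z)" using assms by simp
    then obtain k where "\<forall>i\<in>fst ` Z \<union> snd ` Z. i < k"
      using finite_nat_set_iff_bounded by blast
    then show ?thesis
      by (intro that[of k]) (metis UnI1 UnI2 fst_conv snd_conv imageI)
  qed
  have out: "(k, 0) \<notin> Z" "(0, k) \<notin> Z"
    using k[of k 0] k[of 0 k] by auto
  have "concave_corners Z \<subseteq> {..k} \<times> {..k}"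
  proof
    fix c assume c: "c \<in> concave_corners Z"
    obtain x y where xy: "c = (x, y)" by fastforce
    have "x \<le> k"
    proof (rule ccontr)
      assume "\<not> x \<le> k"
      then have "(k, 0) \<le> (x, y)" by simp
      with c xy out(1) have "(k, 0) = (x, y)" unfolding concave_corners_def by blast
      with \<open>\<not> x \<le> k\<close> show False by simp
    qed
    moreover have "y \<le> k"
    proof (rule ccontr)
      assume "\<not> y \<le> k"
      then have "(0, k) \<le> (x, y)" by simp
      with c xy out(2) have "(0, k) = (x, y)" unfolding concave_corners_def by blast
      with \<open>\<not> y \<le> k\<close> show False by simp
    qed
    ultimately show "c \<in> {..k} \<times> {..k}" using xy by simp
  qed
  then show "finite (concave_corners Z)"
    by (rule finite_subset) simp
  show "concave_corners Z \<noteq> {}"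
    using concave_corner_below[OF out(1)] by blast
qed

lemma longest_row_eq:
  assumes "finite Z" "zero_set Z"
  shows "longest_row Z = card {x. (x, 0) \<in> Z}"
proof -
  have eq: "card (row Z y) = card {x. (x, y) \<in> Z}" for y
  proof -
    have "row Z y = (\<lambda>x. (x, y)) ` {x. (x, y) \<in> Z}"
      by (auto simp: row_def)
    then show ?thesis by (simp add: card_image inj_on_def)
  qed
  have "{x. (x, 0) \<in> Z} \<subseteq> fst ` Z"
    by (auto intro: image_eqI[rotated])
  then have fin: "finite {x. (x, 0) \<in> Z}"
    using assms(1) by (rule finite_subset[OF _ finite_imageI])
  have "(x, 0) \<in> Z" if "(x, y) \<in> Z" for x y
  proof -
    have "(x, 0) \<le> (x, y)" by simp
    with that assms(2) show ?thesis unfolding zero_set_def by blast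
  qed
  then have le: "card {x. (x, y) \<in> Z} \<le> card {x. (x, 0) \<in> Z}" for y
    by (intro card_mono fin Collect_mono) blast
  have "range (\<lambda>y. card {x. (x, y) \<in> Z}) \<subseteq> {..card {x. (x, 0) \<in> Z}}"
    using le by (simp add: image_subset_iff)
  then have "finite (range (\<lambda>y. card {x. (x, y) \<in> Z}))"
    by (rule finite_subset) simp
  then show ?thesis
    unfolding longest_row_def eq using le by (intro Max_eqI) blast+
qed

lemma longest_column_eq:
  assumes "finite Z" "zero_set Z"
  shows "longest_column Z = card {y. (0, y) \<in> Z}"
proof -
  have eq: "card (column Z x) = card {y. (x, y) \<in> Z}" for x
  proof -
    have "column Z x = (\<lambda>y. (x, y)) ` {y. (x, y) \<in> Z}"
      by (auto simp: column_def)
    then show ?thesis by (simp add: card_image inj_on_def)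
  qed
  have "{y. (0, y) \<in> Z} \<subseteq> snd ` Z"
    by (auto intro: image_eqI[rotated])
  then have fin: "finite {y. (0, y) \<in> Z}"
    using assms(1) by (rule finite_subset[OF _ finite_imageI])
  have "(0, y) \<in> Z" if "(x, y) \<in> Z" for x y
  proof -
    have "(0, y) \<le> (x, y)" by simp
    with that assms(2) show ?thesis unfolding zero_set_def by blast
  qed
  then have le: "card {y. (x, y) \<in> Z} \<le> card {y. (0, y) \<in> Z}" for x
    by (intro card_mono fin Collect_mono) blast
  have "range (\<lambda>x. card {y. (x, y) \<in> Z}) \<subseteq> {..card {y. (0, y) \<in> Z}}"
    using le by (simp add: image_subset_iff)
  then have "finite (range (\<lambda>x. card {y. (x, y) \<in> Z}))"
    by (rule finite_subset) simp
  then show ?thesis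
    unfolding longest_column_def eq using le by (intro Max_eqI) blast+
qed

end

(* Upper bound: for a corner (x, y), the L-shaped set formed by an x times b and an a times y
   rectangle fills x columns and y rows in the first step, and these fill everything else in the
   second.  Lower bound: a set A of fewer than ab points misses some row and some column.  Their
   common vertex sees nothing of A, so it is filled in the second step, by vertices of the empty row
   and column filled in the first.  Such a vertex of the empty row lies in a column with at least b
   points of A, one of the empty column in a row with at least a points of A; if x columns and y rows
   are involved, they contain at least bx + ay - xy points of A. *)

theory Submission
  imports Defs
begin

section \<open>Axis slices of a zero-set and bounds on its corners\<close>

lemma finite_down_closed_nat_eq:
  fixes S :: "nat set"
  assumes "finite S" and down: "\<And>x y. x \<in> S \<Longrightarrow> y \<le> x \<Longrightarrow> y \<in> S"
  shows "S = {..<card S}"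
proof (cases "S = {}")
  case False
  have "S = {..Max S}"
    using Max_ge[OF assms(1)] down[OF Max_in[OF assms(1) False]] by blast
  then have "card S = Suc (Max S)"
    by (metis card_atMost)
  with \<open>S = {..Max S}\<close> show ?thesis
    by (simp add: lessThan_Suc_atMost)
qed simp

lemma zero_setD: "zero_set Z \<Longrightarrow> (x', y') \<in> Z \<Longrightarrow> x \<le> x' \<Longrightarrow> y \<le> y' \<Longrightarrow> (x, y) \<in> Z"
  unfolding zero_set_def by (metis Pair_le)

text \<open>The slices along the axes are finite and downward closed, hence initial segments. So on
  an axis, lying outside \<open>Z\<close> is a plain threshold condition on one neighbour
  count.\<close>

lemma mem_zero_set_axes:
  assumes "finite Z" and "zero_set Z"
  shows "(x, 0) \<in> Z \<longleftrightarrow> x < longest_row Z"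
    and "(0, y) \<in> Z \<longleftrightarrow> y < longest_column Z"
proof -
  have "finite {x. (x, 0) \<in> Z}" "finite {y. (0, y) \<in> Z}"
    using assms(1) by (auto intro!: finite_vimageI[unfolded vimage_def] injI)
  then have "{x. (x, 0) \<in> Z} = {..<longest_row Z}" "{y. (0, y) \<in> Z} = {..<longest_column Z}"
    unfolding longest_row_eq[OF assms] longest_column_eq[OF assms]
    by (intro finite_down_closed_nat_eq; use zero_setD[OF assms(2)] in blast)+
  then show "(x, 0) \<in> Z \<longleftrightarrow> x < longest_row Z" "(0, y) \<in> Z \<longleftrightarrow> y < longest_column Z"
    by blast+
qed

text \<open>The axis points at distance \<open>longest_row Z\<close> and
  \<open>longest_column Z\<close> are outside \<open>Z\<close>; a corner exceeding one of these
  lengths would lie strictly above such a point, against minimality.\<close>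

lemma concave_corner_bounds:
  assumes "finite Z" and "zero_set Z" and c: "(x, y) \<in> concave_corners Z"
  shows "x \<le> longest_row Z" and "y \<le> longest_column Z"
proof -
  have min: "q = (x, y)" if "q \<notin> Z" "q \<le> (x, y)" for q
    using c that unfolding concave_corners_def by blast
  show "x \<le> longest_row Z"
    using min[of "(longest_row Z, 0)"] mem_zero_set_axes[OF assms(1,2)] by force
  show "y \<le> longest_column Z"
    using min[of "(0, longest_column Z)"] mem_zero_set_axes[OF assms(1,2)] by force
qed

section \<open>Counting along fibres\<close>

lemma card_fibres_ge:
  assumes "finite A" and "finite J" and "\<And>j. j \<in> J \<Longrightarrow> b \<le> card {w \<in> A. f w = j}"
  shows "b * card J \<le> card {w \<in> A. f w \<in> J}"
proof -
  have "{w \<in> A. f w \<in> J} = (\<Union>j\<in>J. {w \<in> A. f w = j})"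
    by blast
  moreover have "card (\<Union>j\<in>J. {w \<in> A. f w = j}) = (\<Sum>j\<in>J. card {w \<in> A. f w = j})"
    using assms by (intro card_UN_disjoint) auto
  moreover have "(\<Sum>j\<in>J. b) \<le> (\<Sum>j\<in>J. card {w \<in> A. f w = j})"
    using assms(3) by (rule sum_mono)
  ultimately show ?thesis
    by (simp add: mult.commute)
qed

text \<open>Pigeonhole; with \<open>f\<close> a coordinate projection it supplies a column or row
  free of \<open>A\<close>.\<close>

lemma exists_unused_below:
  assumes "finite A" and "card A < n"
  obtains j :: nat where "j < n" and "\<And>w. w \<in> A \<Longrightarrow> f w \<noteq> j"
proof -
  have "\<not> {..<n} \<subseteq> f ` A"
  proof
    assume "{..<n} \<subseteq> f ` A"
    then have "card {..<n} \<le> card (f ` A)"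
      using assms(1) by (intro card_mono) auto
    with card_image_le[OF assms(1), of f] assms(2) show False
      by simp
  qed
  then show ?thesis
    using that by blast
qed

section \<open>Sufficient conditions for being filled in one step\<close>

lemma subset_growth_step: "A \<subseteq> growth_step Z n m A"
  by (simp add: growth_step_def)

lemma growth_step_subset: "A \<subseteq> rect n m \<Longrightarrow> growth_step Z n m A \<subseteq> rect n m"
  by (auto simp: growth_step_def)

text \<open>The complement of a zero-set is upward closed, so lower bounds on the two counts
  suffice.\<close>

lemma in_growth_stepI:
  assumes "zero_set Z" and "(x, y) \<notin> Z" and "v \<in> rect n m"
    and "x \<le> card (row_nbrs n m v \<inter> A)" and "y \<le> card (col_nbrs n m v \<inter> A)"
  shows "v \<in> growth_step Z n m A"
  using assms(2,3) zero_setD[OF assms(1) _ assms(4,5)] by (auto simp: growth_step_def)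

text \<open>As \<open>w\<close> is not in \<open>A\<close>, it is none of the first \<open>x\<close>
  points of its row, so all of these count as its neighbours.\<close>

lemma card_row_nbrs_ge:
  assumes "w \<in> rect n m" and "w \<notin> A" and "x \<le> n" and "\<And>k. k < x \<Longrightarrow> (k, snd w) \<in> A"
  shows "x \<le> card (row_nbrs n m w \<inter> A)"
proof -
  have "k \<noteq> fst w" if "k < x" for k
    using assms(2) assms(4)[OF that] by auto
  then have "(\<lambda>k. (k, snd w)) ` {..<x} \<subseteq> row_nbrs n m w \<inter> A"
    using assms by (auto simp: row_nbrs_def rect_def mem_Times_iff)
  moreover have "finite (row_nbrs n m w \<inter> A)"
    by (simp add: row_nbrs_def rect_def)
  ultimately have "card ((\<lambda>k. (k, snd w)) ` {..<x}) \<le> card (row_nbrs n m w \<inter> A)"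
    by (rule card_mono[rotated])
  then show ?thesis
    by (simp add: card_image inj_on_def)
qed

lemma card_col_nbrs_ge:
  assumes "w \<in> rect n m" and "w \<notin> A" and "y \<le> m" and "\<And>k. k < y \<Longrightarrow> (fst w, k) \<in> A"
  shows "y \<le> card (col_nbrs n m w \<inter> A)"
proof -
  have "k \<noteq> snd w" if "k < y" for k
    using assms(2) assms(4)[OF that] by auto
  then have "Pair (fst w) ` {..<y} \<subseteq> col_nbrs n m w \<inter> A"
    using assms by (auto simp: col_nbrs_def rect_def mem_Times_iff)
  moreover have "finite (col_nbrs n m w \<inter> A)"
    by (simp add: col_nbrs_def rect_def)
  ultimately have "card (Pair (fst w) ` {..<y}) \<le> card (col_nbrs n m w \<inter> A)"
    by (rule card_mono[rotated])
  then show ?thesis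
    by (simp add: card_image inj_on_def)
qed

section \<open>Upper bound: L-shaped sets\<close>

lemma card_L_shape:
  fixes x y a b :: nat
  assumes "x \<le> a" and "y \<le> b"
  shows "int (card ({..<x} \<times> {..<b} \<union> {..<a} \<times> {..<y})) =
    int b * int x + int a * int y - int x * int y"
proof -
  \<comment> \<open>The bounds on \<open>x\<close> and \<open>y\<close> make the overlap exactly an
    \<open>x\<close> by \<open>y\<close> rectangle. Inclusion-exclusion is kept free of subtraction
    until it is moved to the integers.\<close>
  have "({..<x} \<times> {..<b}) \<inter> ({..<a} \<times> {..<y}) = {..<x} \<times> {..<y}"
    using assms by auto
  then have "x * b + a * y = card ({..<x} \<times> {..<b} \<union> {..<a} \<times> {..<y}) + x * y"
    using card_Un_Int[of "{..<x} \<times> {..<b}" "{..<a} \<times> {..<y}"] by simp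
  then have "int (x * b + a * y) = int (card ({..<x} \<times> {..<b} \<union> {..<a} \<times> {..<y}) + x * y)"
    by (rule arg_cong)
  then show ?thesis
    by (simp add: algebra_simps)
qed

lemma L_shape_two_steps:
  assumes Z: "zero_set Z" "(a, 0) \<notin> Z" "(0, b) \<notin> Z" "(x, y) \<notin> Z"
    and le: "x \<le> a" "y \<le> b" "a \<le> n" "b \<le> m"
    and A: "A = {..<x} \<times> {..<b} \<union> {..<a} \<times> {..<y}"
  shows "A \<subseteq> rect n m" and "growth_step Z n m (growth_step Z n m A) = rect n m"
proof -
  let ?T = "growth_step Z n m A"
  show sub: "A \<subseteq> rect n m"
    using le by (auto simp: A rect_def)
  \<comment> \<open>A point of such a column outside \<open>A\<close> has all \<open>b\<close>
    points of the vertical rectangle in its column; since \<open>(0, b)\<close> is outside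
    \<open>Z\<close>, no row neighbours are required.\<close>
  have full_col: "w \<in> ?T" if "w \<in> rect n m" "fst w < x" for w
  proof (cases "w \<in> A")
    case False
    have "b \<le> card (col_nbrs n m w \<inter> A)"
      using that False le by (intro card_col_nbrs_ge) (auto simp: A)
    with that show ?thesis
      by (intro in_growth_stepI[OF Z(1) Z(3)]) auto
  qed (use subset_growth_step in blast)
  have full_row: "w \<in> ?T" if "w \<in> rect n m" "snd w < y" for w
  proof (cases "w \<in> A")
    case False
    have "a \<le> card (row_nbrs n m w \<inter> A)"
      using that False le by (intro card_row_nbrs_ge) (auto simp: A)
    with that show ?thesis
      by (intro in_growth_stepI[OF Z(1) Z(2)]) auto
  qed (use subset_growth_step in blast)
  have "w \<in> growth_step Z n m ?T" if w: "w \<in> rect n m" for w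
  proof (cases "w \<in> ?T")
    case False
    \<comment> \<open>The roles cross: the \<open>x\<close> filled columns provide row neighbours,
      the \<open>y\<close> filled rows provide column neighbours.\<close>
    have "x \<le> card (row_nbrs n m w \<inter> ?T)" "y \<le> card (col_nbrs n m w \<inter> ?T)"
      using w False le
      by (intro card_row_nbrs_ge card_col_nbrs_ge; auto intro: full_row full_col simp: rect_def mem_Times_iff)+
    with w show ?thesis
      by (intro in_growth_stepI[OF Z(1) Z(4)]) auto
  qed (use subset_growth_step in blast)
  then show "growth_step Z n m ?T = rect n m"
    using growth_step_subset[OF growth_step_subset[OF sub]] by blast
qed

section \<open>Lower bound: sets that fill the rectangle in two steps\<close>

lemma card_ge_corner_value:
  fixes A :: "(nat \<times> nat) set" and J I :: "nat set"
  assumes "finite A" and fin: "finite J" "finite I"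
    and "\<And>j. j \<in> J \<Longrightarrow> b \<le> card {w \<in> A. fst w = j}"
    and "\<And>i. i \<in> I \<Longrightarrow> a \<le> card {w \<in> A. snd w = i}"
  shows "int b * int (card J) + int a * int (card I) - int (card J) * int (card I) \<le> int (card A)"
proof -
  let ?P = "{w \<in> A. fst w \<in> J}" and ?Q = "{w \<in> A. snd w \<in> I}"
  have P: "b * card J \<le> card ?P" and Q: "a * card I \<le> card ?Q"
    using assms by (auto intro!: card_fibres_ge)
  \<comment> \<open>Points counted both by column and by row lie in \<open>J \<times> I\<close>;
    this is the source of the subtracted product.\<close>
  have "card (?P \<inter> ?Q) \<le> card (J \<times> I)"
    using fin by (intro card_mono) (auto simp: mem_Times_iff)
  moreover have "card ?P + card ?Q = card (?P \<union> ?Q) + card (?P \<inter> ?Q)"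
    using assms by (intro card_Un_Int) auto
  moreover have "card (?P \<union> ?Q) \<le> card A"
    using assms by (intro card_mono) auto
  ultimately have "b * card J + a * card I \<le> card A + card J * card I"
    using P Q by (simp add: card_cartesian_product)
  then have "int (b * card J + a * card I) \<le> int (card A + card J * card I)"
    by (simp only: of_nat_le_iff)
  then show ?thesis
    by simp
qed

lemma two_step_card_ge_corner:
  assumes fZ: "finite Z" and zZ: "zero_set Z"
    and a: "a = longest_row Z" and b: "b = longest_column Z"
    and mn: "m > a * b" "n > a * b"
    and sub: "A \<subseteq> rect n m" and full: "growth_step Z n m (growth_step Z n m A) = rect n m"
  shows "\<exists>(x, y)\<in>concave_corners Z. int b * int x + int a * int y - int x * int y \<le> int (card A)"
proof (cases "card A < a * b")
  \<comment> \<open>A large \<open>A\<close> already beats a corner on the first axis: its value is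
    \<open>b * x\<close> with \<open>x \<le> a\<close>, hence at most \<open>a * b\<close>.\<close>
  case False
  have "(a, 0) \<notin> Z"
    using mem_zero_set_axes[OF fZ zZ] a by simp
  then obtain c where c: "c \<in> concave_corners Z" "c \<le> (a, 0)"
    using concave_corner_below by blast
  then obtain x where x: "c = (x, 0)" "x \<le> a"
    by (cases c) auto
  then have "b * x \<le> card A"
    using False by (metis le_trans linorder_not_less mult.commute mult_le_mono1)
  then have "int b * int x \<le> int (card A)"
    by (metis of_nat_le_iff of_nat_mult)
  then show ?thesis
    using c(1) x by (intro bexI[of _ "(x, 0)"]) auto
next
  case True
  note axes = mem_zero_set_axes[OF fZ zZ, folded a b]
  let ?T = "growth_step Z n m A"
  have finA: "finite A"
    using sub by (rule finite_subset) (simp add: rect_def)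
  obtain j0 where j0: "j0 < n" "\<And>w. w \<in> A \<Longrightarrow> fst w \<noteq> j0"
    using exists_unused_below[OF finA, of n] True mn by (metis less_trans)
  obtain i0 where i0: "i0 < m" "\<And>w. w \<in> A \<Longrightarrow> snd w \<noteq> i0"
    using exists_unused_below[OF finA, of m] True mn by (metis less_trans)
  have row0: "row_nbrs n m (j, i0) \<inter> A = {}" for j
    using i0 by (auto simp: row_nbrs_def)
  have col0: "col_nbrs n m (j0, i) \<inter> A = {}" for i
    using j0 by (auto simp: col_nbrs_def)
  \<comment> \<open>Row \<open>i0\<close> contains no point of \<open>A\<close>, so the row count is
    0 and only the column count can push the pair out of \<open>Z\<close>; on that axis the
    threshold is \<open>b\<close>.\<close>
  have col_ge: "b \<le> card {w \<in> A. fst w = j}" if "(j, i0) \<in> ?T" for j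
  proof -
    have "(j, i0) \<notin> A"
      using i0 by force
    with that have "(0, card (col_nbrs n m (j, i0) \<inter> A)) \<notin> Z"
      by (simp add: growth_step_def row0)
    then have "b \<le> card (col_nbrs n m (j, i0) \<inter> A)"
      by (simp add: axes)
    also have "\<dots> \<le> card {w \<in> A. fst w = j}"
      using finA by (intro card_mono) (auto simp: col_nbrs_def)
    finally show ?thesis .
  qed
  have row_ge: "a \<le> card {w \<in> A. snd w = i}" if "(j0, i) \<in> ?T" for i
  proof -
    have "(j0, i) \<notin> A"
      using j0 by force
    with that have "(card (row_nbrs n m (j0, i) \<inter> A), 0) \<notin> Z"
      by (simp add: growth_step_def col0)
    then have "a \<le> card (row_nbrs n m (j0, i) \<inter> A)"
      by (simp add: axes)
    also have "\<dots> \<le> card {w \<in> A. snd w = i}"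
      using finA by (intro card_mono) (auto simp: row_nbrs_def)
    finally show ?thesis .
  qed
  \<comment> \<open>Positivity of \<open>b\<close> keeps \<open>(j0, i0)\<close> out of the first
    step: its column is free of \<open>A\<close>, while being filled would force at least
    \<open>b\<close> points there.\<close>
  have b0: "0 < b"
    using True by (cases b) auto
  have v: "(j0, i0) \<in> rect n m"
    using j0 i0 by (simp add: rect_def)
  have "{w \<in> A. fst w = j0} = {}"
    using j0 by blast
  then have "(j0, i0) \<notin> ?T"
    using col_ge[of j0] b0 by (metis card.empty not_le)
  \<comment> \<open>The vertex is new in the second step, so its counts with respect to
    \<open>?T\<close> must lie outside \<open>Z\<close>.\<close>
  then have nZ: "(card (row_nbrs n m (j0, i0) \<inter> ?T), card (col_nbrs n m (j0, i0) \<inter> ?T)) \<notin> Z"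
    using v unfolding full[symmetric] by (subst (asm) growth_step_def) blast
  let ?J = "fst ` (row_nbrs n m (j0, i0) \<inter> ?T)" and ?I = "snd ` (col_nbrs n m (j0, i0) \<inter> ?T)"
  \<comment> \<open>Neighbours in one row differ in the first coordinate, those in one column in the
    second, so projecting loses nothing.\<close>
  have card_eq: "card ?J = card (row_nbrs n m (j0, i0) \<inter> ?T)" "card ?I = card (col_nbrs n m (j0, i0) \<inter> ?T)"
    by (auto intro!: card_image inj_onI simp: row_nbrs_def col_nbrs_def prod_eq_iff)
  obtain x y where c: "(x, y) \<in> concave_corners Z" "x \<le> card ?J" "y \<le> card ?I"
    using concave_corner_below[OF nZ] unfolding card_eq Bex_def split_paired_Ex Pair_le by blast
  \<comment> \<open>Trimming to exactly \<open>x\<close> columns and \<open>y\<close> rows makes the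
    counting bound yield the value at the corner itself, with no monotonicity argument.\<close>
  obtain J where J: "J \<subseteq> ?J" "card J = x" "finite J"
    using c(2) by (rule obtain_subset_with_card_n)
  obtain I where I: "I \<subseteq> ?I" "card I = y" "finite I"
    using c(3) by (rule obtain_subset_with_card_n)
  have "int b * int (card J) + int a * int (card I) - int (card J) * int (card I) \<le> int (card A)"
  proof (rule card_ge_corner_value[OF finA J(3) I(3)])
    show "b \<le> card {w \<in> A. fst w = j}" if "j \<in> J" for j
      using that J(1) by (intro col_ge) (auto simp: row_nbrs_def)
    show "a \<le> card {w \<in> A. snd w = i}" if "i \<in> I" for i
      using that I(1) by (intro row_ge) (auto simp: col_nbrs_def)
  qed
  then show ?thesis
    using c(1) J(2) I(2) by (intro bexI[of _ "(x, y)"]) auto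
qed

theorem lemma8p1:
  fixes Z :: "(nat \<times> nat) set" and a b m n :: nat
  assumes "finite Z" and "zero_set Z"
    and "a = longest_row Z" and "b = longest_column Z"
    and "m > a * b" and "n > a * b"
  shows "int (gamma2 Z m n) =
    Min ((\<lambda>(x, y). int b * int x + int a * int y - int x * int y) ` concave_corners Z)"
proof (rule antisym)
  let ?C = "{A. A \<subseteq> rect n m \<and> growth_step Z n m (growth_step Z n m A) = rect n m}"
  note axes = mem_zero_set_axes[OF assms(1,2), folded assms(3,4)]
  note corners = concave_corners_finite_nonempty[OF assms(1)]
  \<comment> \<open>Both sides say that the origin is outside \<open>Z\<close>. This excludes a
    product \<open>a * b\<close> that vanishes while one factor is positive, so the L-shape fits
    into the rectangle.\<close>
  have "a = 0 \<longleftrightarrow> b = 0"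
    using axes(1)[of 0] axes(2)[of 0] by auto
  then have "a \<le> a * b" "b \<le> a * b"
    by (cases a; cases b; simp)+
  then have ab: "a \<le> n" "b \<le> m"
    using assms(5,6) by linarith+
  show "int (gamma2 Z m n) \<le>
    Min ((\<lambda>(x, y). int b * int x + int a * int y - int x * int y) ` concave_corners Z)"
  proof (intro Min.boundedI)
    fix v assume "v \<in> (\<lambda>(x, y). int b * int x + int a * int y - int x * int y) ` concave_corners Z"
    then obtain x y where c: "(x, y) \<in> concave_corners Z"
      and v: "v = int b * int x + int a * int y - int x * int y"
      by auto
    have le: "x \<le> a" "y \<le> b"
      using concave_corner_bounds[OF assms(1,2) c] assms(3,4) by simp_all
    let ?A = "{..<x} \<times> {..<b} \<union> {..<a} \<times> {..<y}"
    have "(x, y) \<notin> Z"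
      using c by (simp add: concave_corners_def)
    then have "?A \<in> ?C"
      using L_shape_two_steps[OF assms(2) _ _ _ le ab refl] axes by simp
    then have "gamma2 Z m n \<le> card ?A"
      unfolding gamma2_def using gamma2_candidates(1) by (intro Min_le finite_imageI imageI)
    then show "int (gamma2 Z m n) \<le> v"
      using card_L_shape[OF le] v by linarith
  qed (use corners in auto)
  \<comment> \<open>The minimum is attained, and the lower bound is applied to a set attaining
    it.\<close>
  have "gamma2 Z m n \<in> card ` ?C"
    unfolding gamma2_def using gamma2_candidates[where Z = Z and n = n and m = m]
    by (metis (no_types, lifting) Min_in empty_iff finite_imageI image_is_empty)
  then obtain A where A: "gamma2 Z m n = card A" "A \<subseteq> rect n m"
    "growth_step Z n m (growth_step Z n m A) = rect n m"
    by blast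
  then obtain x y where "(x, y) \<in> concave_corners Z"
    "int b * int x + int a * int y - int x * int y \<le> int (gamma2 Z m n)"
    using two_step_card_ge_corner[OF assms A(2,3)] by auto
  then show "Min ((\<lambda>(x, y). int b * int x + int a * int y - int x * int y) ` concave_corners Z)
    \<le> int (gamma2 Z m n)"
    using corners(1) by (intro Min.coboundedI[THEN order_trans]) (auto intro!: rev_image_eqI)
qed

end
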